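(* Let $I\subset[0,\infty)$ be an interval, let $a,b\in I$ with $a<b$, and let $f:I\to\mathbb{R}$ be differentiable on the interior $I^{\circ}$ of $I$ and at $a$ and $b$, with $f'\in L[a,b]$. Let $p>1$, $\frac1p+\frac1q=1$, let $s\in(0,1]$ be fixed, and suppose that $|f'|^q$ is $s$-convex in the second sense on $[a,b]$. Then for each $x\in[a,b]$, $$\left|f(x)-\frac{1}{b-a}\int_a^b f(u)\,du\right|\le \frac{b-a}{(p+1)^{1/p}}\Big[\Big(\frac{b-x}{b-a}\Big)^{p+1}+\Big(\frac{x-a}{b-a}\Big)^{p+1}\Big]^{\frac1p}\Big(\frac{|f'(a)|^q+|f'(b)|^q}{s+1}\Big)^{\frac1q}.$$
   Context: For fixed $s\in(0,1]$, a real function $g$ is $s$-convex in the second sense on $[a,b]\subset[0,\infty)$ if $g(\alpha x+(1-\alpha)y)\le \alpha^s g(x)+(1-\alpha)^s g(y)$ for all $x,y\in[a,b]$ and $\alpha\in[0,1]$. $L[a,b]$ denotes the Lebesgue integrable functions on $[a,b]$. If $a$ or $b$ is an endpoint of $I$, differentiability there is one-sided (within $I$). *)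

theory Defs
  imports "HOL-Analysis.Analysis"
begin

(* s-convexity in the second sense, intended for 0 < s <= 1 and A an interval in [0, oo).
   Since s > 0, the endpoint values 0 powr s = 0 and 1 powr s = 1 are the usual ones. *)
definition s_convex_second_on :: "real \<Rightarrow> real set \<Rightarrow> (real \<Rightarrow> real) \<Rightarrow> bool" where
  "s_convex_second_on s A g \<longleftrightarrow>
    (\<forall>x\<in>A. \<forall>y\<in>A. \<forall>\<alpha>\<in>{0..1}.
      g (\<alpha> * x + (1 - \<alpha>) * y) \<le> \<alpha> powr s * g x + (1 - \<alpha>) powr s * g y)"

end

(* With the kernel K(u) = u - a for u \<le> x and u - b for u > x, integration by parts gives
   (b - a) f(x) - \<integral> f = \<integral> K f'.  Writing u as a convex combination of a and b, s-convexity
   gives |f'(u)|^q \<le> G(u) = ((b - u)/(b - a))^s |f'(a)|^q + ((u - a)/(b - a))^s |f'(b)|^q, and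
   \<integral> G = (b - a) (|f'(a)|^q + |f'(b)|^q)/(s + 1).  Hoelder's inequality then bounds |\<integral> K f'| by
   (\<integral> |K|^p)^(1/p) (\<integral> G)^(1/q). *)

theory Submission
  imports Defs
begin

lemma has_integral_shifted_powr:
  fixes c d r :: real
  assumes "c \<le> d" "0 < r"
  shows "((\<lambda>u. (u - c) powr r) has_integral (d - c) powr (r + 1) / (r + 1)) {c..d}"
    and "((\<lambda>u. (d - u) powr r) has_integral (d - c) powr (r + 1) / (r + 1)) {c..d}"
proof -
  have "((\<lambda>u. (u - c) powr r) has_integral
      (d - c) powr (r + 1) / (r + 1) - (c - c) powr (r + 1) / (r + 1)) {c..d}"
  \<comment> \<open>The power rule for \<open>powr\<close> needs a positive base, so the
    antiderivative is differentiated only inside the interval; at the endpoint where the base is 0,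
    continuity suffices. The mirrored integral below is treated alike.\<close>
  proof (rule fundamental_theorem_of_calculus_interior[OF assms(1)])
    show "continuous_on {c..d} (\<lambda>u. (u - c) powr (r + 1) / (r + 1))"
      using assms by (auto intro!: continuous_intros continuous_on_powr')
    fix u assume "u \<in> {c<..<d}"
    then have D: "((\<lambda>u. (u - c) powr (r + 1)) has_real_derivative
        (r + 1) * (u - c) powr (r + 1 - of_nat 1) * 1) (at u)"
      by (intro DERIV_fun_powr) (auto intro!: derivative_eq_intros)
    show "((\<lambda>u. (u - c) powr (r + 1) / (r + 1)) has_vector_derivative (u - c) powr r) (at u)"
      using assms DERIV_cdivide[OF D, of "r + 1"]
      unfolding has_real_derivative_iff_has_vector_derivative[symmetric] by simp
  qed
  then show "((\<lambda>u. (u - c) powr r) has_integral (d - c) powr (r + 1) / (r + 1)) {c..d}"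
    using assms by simp
  have "((\<lambda>u. (d - u) powr r) has_integral
      - ((d - d) powr (r + 1) / (r + 1)) - - ((d - c) powr (r + 1) / (r + 1))) {c..d}"
  proof (rule fundamental_theorem_of_calculus_interior[OF assms(1)])
    show "continuous_on {c..d} (\<lambda>u. - ((d - u) powr (r + 1) / (r + 1)))"
      using assms by (auto intro!: continuous_intros continuous_on_powr')
    fix u assume "u \<in> {c<..<d}"
    then have D: "((\<lambda>u. (d - u) powr (r + 1)) has_real_derivative
        (r + 1) * (d - u) powr (r + 1 - of_nat 1) * (- 1)) (at u)"
      by (intro DERIV_fun_powr) (auto intro!: derivative_eq_intros)
    show "((\<lambda>u. - ((d - u) powr (r + 1) / (r + 1))) has_vector_derivative (d - u) powr r) (at u)"
      using assms DERIV_minus[OF DERIV_cdivide[OF D, of "r + 1"]]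
      unfolding has_real_derivative_iff_has_vector_derivative[symmetric] by simp
  qed
  then show "((\<lambda>u. (d - u) powr r) has_integral (d - c) powr (r + 1) / (r + 1)) {c..d}"
    using assms by simp
qed

lemma conjugate_exponent_gt_1:
  fixes p q :: real
  assumes "p > 1" "1 / p + 1 / q = 1"
  shows "q > 1"
proof -
  have "1 / p > 0" "1 / p < 1" using assms(1) by simp_all
  then have "1 / q > 0" "1 / q < 1" using assms(2) by linarith+
  then show ?thesis by simp
qed

text \<open>Integrating Young's inequality for the normalised functions gives the bound. Only a
  pointwise majorant \<open>f u * g u\<close> of \<open>h\<close> enters, so \<open>g\<close> may be
  an upper bound for \<open>\<bar>f'\<bar>\<close> instead of \<open>\<bar>f'\<bar>\<close> itself,
  and integrability of the product \<open>f u * g u\<close> is never asked for.\<close>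

lemma Hoelder_has_integral:
  fixes f g h :: "real \<Rightarrow> real"
  assumes pq: "p > 1" "1 / p + 1 / q = 1"
    and h: "(h has_integral W) S"
    and f: "((\<lambda>u. f u powr p) has_integral P) S"
    and g: "((\<lambda>u. g u powr q) has_integral Q) S"
    and le: "\<And>u. u \<in> S \<Longrightarrow> 0 \<le> f u \<and> 0 \<le> g u \<and> \<bar>h u\<bar> \<le> f u * g u"
  shows "\<bar>W\<bar> \<le> P powr (1 / p) * Q powr (1 / q)"
proof -
  have P: "P \<ge> 0" by (rule has_integral_nonneg[OF f]) simp
  have Q: "Q \<ge> 0" by (rule has_integral_nonneg[OF g]) simp
  have q: "q > 1" using pq by (rule conjugate_exponent_gt_1)
  text \<open>Perturbing both integrals by \<open>e\<close> makes the normalisation before Young's inequality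
    meaningful even when one of them vanishes.\<close>
  have bound: "\<bar>W\<bar> \<le> (P + e) powr (1 / p) * (Q + e) powr (1 / q)" if e: "e > 0" for e
  proof -
    define A where "A = (P + e) powr (1 / p)"
    define B where "B = (Q + e) powr (1 / q)"
    have A: "A > 0" "A powr p = P + e" and B: "B > 0" "B powr q = Q + e"
      using P Q e pq q by (auto simp: A_def B_def powr_powr)
    \<comment> \<open>\<open>A * B\<close> times the right side of Young's inequality for
      \<open>f u / A\<close> and \<open>g u / B\<close>, with \<open>A powr p\<close> and
      \<open>B powr q\<close> replaced by their values.\<close>
    let ?y = "\<lambda>u. f u powr p * (A * B / ((P + e) * p)) + g u powr q * (A * B / ((Q + e) * q))"
    have y: "(?y has_integral P * (A * B / ((P + e) * p)) + Q * (A * B / ((Q + e) * q))) S"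
      by (intro has_integral_add has_integral_mult_left f g)
    have hy: "norm (h u) \<le> ?y u" if u: "u \<in> S" for u
    proof -
      have "f u / A * (g u / B) \<le> (f u / A) powr p / p + (g u / B) powr q / q"
        using le[OF u] A B pq q by (intro Youngs_inequality) auto
      also have "\<dots> = f u powr p / ((P + e) * p) + g u powr q / ((Q + e) * q)"
        using le[OF u] A B by (simp add: powr_divide)
      finally have "A * B * (f u / A * (g u / B)) \<le> A * B * (f u powr p / ((P + e) * p) + g u powr q / ((Q + e) * q))"
        using A B by (intro mult_left_mono) auto
      then have "f u * g u \<le> ?y u"
        using A B by (simp add: algebra_simps)
      then show ?thesis using le[OF u] by simp
    qed
    have "norm (integral S h) \<le> integral S ?y"
      using h y hy by (intro integral_norm_bound_integral) (auto simp: has_integral_integrable)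
    then have "\<bar>W\<bar> \<le> P * (A * B / ((P + e) * p)) + Q * (A * B / ((Q + e) * q))"
      using integral_unique[OF h] integral_unique[OF y] by simp
    also have "\<dots> = A * B * (P / (P + e) * (1 / p) + Q / (Q + e) * (1 / q))"
      by (simp add: algebra_simps)
    also have "\<dots> \<le> A * B * (1 * (1 / p) + 1 * (1 / q))"
      using A B P Q e pq q by (intro mult_left_mono add_mono mult_right_mono) auto
    also have "\<dots> = A * B" using pq by simp
    finally show ?thesis by (simp add: A_def B_def)
  qed
  \<comment> \<open>Let \<open>e\<close> tend to 0 from the right. If \<open>P\<close> or
    \<open>Q\<close> is 0, the limit is still right because the exponents are positive and the bases
    nonnegative.\<close>
  have "((\<lambda>e. (P + e) powr (1 / p) * (Q + e) powr (1 / q)) \<longlongrightarrow>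
      (P + 0) powr (1 / p) * (Q + 0) powr (1 / q)) (at_right 0)"
    using P Q pq q
    by (intro tendsto_mult tendsto_powr' tendsto_intros)
      (auto simp: eventually_at_right_less intro!: eventually_at_rightI[of 0 1])
  moreover have "\<forall>\<^sub>F e in at_right 0. \<bar>W\<bar> \<le> (P + e) powr (1 / p) * (Q + e) powr (1 / q)"
    using bound by (intro eventually_at_rightI[of 0 1]) auto
  ultimately have "\<bar>W\<bar> \<le> (P + 0) powr (1 / p) * (Q + 0) powr (1 / q)"
    by (rule tendsto_lowerbound) simp
  then show ?thesis by simp
qed

text \<open>Integration by parts on each side of \<open>x\<close>: the kernel vanishes at
  \<open>a\<close> and at \<open>b\<close>, and its jump at \<open>x\<close> contributes
  \<open>(x - a) * f x - (x - b) * f x = (b - a) * f x\<close>.\<close>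

lemma has_integral_Ostrowski_kernel:
  fixes f f' :: "real \<Rightarrow> real"
  assumes der: "\<And>u. u \<in> {a..b} \<Longrightarrow> (f has_real_derivative f' u) (at u within {a..b})"
    and x: "a \<le> x" "x \<le> b"
  shows "((\<lambda>u. (if u \<le> x then u - a else u - b) * f' u) has_integral
    (b - a) * f x - integral {a..b} f) {a..b}"
proof -
  have cont: "continuous_on {a..b} f"
    using der DERIV_continuous_on by blast
  \<comment> \<open>The fundamental theorem for \<open>(u - k) * f u\<close>, minus the integral of
    \<open>f\<close>. The shift \<open>k\<close> stays free, to become \<open>a\<close> left of
    \<open>x\<close> and \<open>b\<close> right of it.\<close>
  have part: "((\<lambda>u. (u - k) * f' u) has_integral (d - k) * f d - (c - k) * f c - integral {c..d} f) {c..d}"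
    if cd: "a \<le> c" "c \<le> d" "d \<le> b" for c d k
  proof -
    have "((\<lambda>u. f u + (u - k) * f' u) has_integral (d - k) * f d - (c - k) * f c) {c..d}"
    proof (rule fundamental_theorem_of_calculus[OF cd(2)])
      fix u assume u: "u \<in> {c..d}"
      have "(f has_real_derivative f' u) (at u within {c..d})"
        using cd u by (intro DERIV_subset[OF der]) auto
      then show "((\<lambda>u. (u - k) * f u) has_vector_derivative f u + (u - k) * f' u) (at u within {c..d})"
        unfolding has_real_derivative_iff_has_vector_derivative[symmetric]
        by (auto intro!: derivative_eq_intros)
    qed
    moreover have "(f has_integral integral {c..d} f) {c..d}"
      using cd by (intro integrable_integral integrable_continuous_real continuous_on_subset[OF cont]) auto
    ultimately have "((\<lambda>u. f u + (u - k) * f' u - f u) has_integral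
        (d - k) * f d - (c - k) * f c - integral {c..d} f) {c..d}"
      by (rule has_integral_diff)
    then show ?thesis by simp
  qed
  let ?k = "\<lambda>u. (if u \<le> x then u - a else u - b) * f' u"
  have "(?k has_integral (x - a) * f x - (a - a) * f a - integral {a..x} f) {a..x}"
    by (rule has_integral_eq[OF _ part[of a x a]]) (use x in auto)
  \<comment> \<open>At \<open>u = x\<close> the kernel takes its left value \<open>x - a\<close>;
    changing this one point does not affect the integral.\<close>
  moreover have "(?k has_integral (b - b) * f b - (x - b) * f x - integral {x..b} f) {x..b}"
    by (rule has_integral_spike_finite[OF _ _ part[of x b b], of "{x}"]) (use x in auto)
  ultimately have "(?k has_integral ((x - a) * f x - (a - a) * f a - integral {a..x} f) +
      ((b - b) * f b - (x - b) * f x - integral {x..b} f)) {a..b}"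
    using x by (intro has_integral_combine)
  moreover have "integral {a..x} f + integral {x..b} f = integral {a..b} f"
    using x cont by (intro Henstock_Kurzweil_Integration.integral_combine integrable_continuous_real)
  ultimately show ?thesis
    by (simp add: algebra_simps)
qed

lemma has_integral_Ostrowski_kernel_powr:
  fixes a b x p :: real
  assumes "a \<le> x" "x \<le> b" "0 < p"
  shows "((\<lambda>u. \<bar>if u \<le> x then u - a else u - b\<bar> powr p) has_integral
    ((x - a) powr (p + 1) + (b - x) powr (p + 1)) / (p + 1)) {a..b}"
proof -
  let ?k = "\<lambda>u. \<bar>if u \<le> x then u - a else u - b\<bar> powr p"
  have "(?k has_integral (x - a) powr (p + 1) / (p + 1)) {a..x}"
    by (rule has_integral_eq[OF _ has_integral_shifted_powr(1)]) (use assms in auto)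
  moreover have "(?k has_integral (b - x) powr (p + 1) / (p + 1)) {x..b}"
    by (rule has_integral_spike_finite[OF _ _ has_integral_shifted_powr(2), of "{x}"])
      (use assms in \<open>auto simp: abs_if\<close>)
  ultimately have "(?k has_integral (x - a) powr (p + 1) / (p + 1) + (b - x) powr (p + 1) / (p + 1)) {a..b}"
    using assms by (intro has_integral_combine)
  then show ?thesis by (simp add: add_divide_distrib)
qed

theorem theorem10:
  fixes I :: "real set" and a b s p q x :: real and f f' :: "real \<Rightarrow> real"
  assumes "is_interval I" and "I \<subseteq> {0..}"
    and "a \<in> I" and "b \<in> I" and "a < b"
    and "\<And>u. u \<in> interior I \<union> {a, b} \<Longrightarrow> (f has_real_derivative f' u) (at u within I)"
    and "set_integrable lebesgue {a..b} f'"
    and "p > 1" and "1 / p + 1 / q = 1"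
    and "0 < s" and "s \<le> 1"
    and "s_convex_second_on s {a..b} (\<lambda>u. \<bar>f' u\<bar> powr q)"
    and "x \<in> {a..b}"
  shows "\<bar>f x - 1 / (b - a) * (LINT u:{a..b}|lebesgue. f u)\<bar>
    \<le> (b - a) / (p + 1) powr (1 / p)
      * (((b - x) / (b - a)) powr (p + 1) + ((x - a) / (b - a)) powr (p + 1)) powr (1 / p)
      * ((\<bar>f' a\<bar> powr q + \<bar>f' b\<bar> powr q) / (s + 1)) powr (1 / q)"
proof -
  define A where "A = \<bar>f' a\<bar> powr q"
  define B where "B = \<bar>f' b\<bar> powr q"
  define l where "l = b - a"
  have l: "l > 0" using assms by (simp add: l_def)
  have x: "a \<le> x" "x \<le> b" using assms by auto
  have q: "q > 1" using assms(8,9) by (rule conjugate_exponent_gt_1)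
  have AB: "A \<ge> 0" "B \<ge> 0" by (auto simp: A_def B_def)
  have sub: "{a..b} \<subseteq> I"
    using assms(1,3,4) by (meson atLeastAtMost_iff mem_is_interval_1_I subsetI)
  have der: "(f has_real_derivative f' u) (at u within {a..b})" if u: "u \<in> {a..b}" for u
  proof (rule DERIV_subset[OF assms(6) sub])
    have "{a<..<b} \<subseteq> interior I"
      using sub by (intro interior_maximal) auto
    then show "u \<in> interior I \<union> {a, b}"
      using u by (cases "u = a \<or> u = b") auto
  qed
  have cont: "continuous_on {a..b} f"
    using der DERIV_continuous_on by blast
  \<comment> \<open>Continuity makes \<open>f\<close> absolutely integrable, so its Lebesgue and
    gauge integrals agree.\<close>
  have lint: "(LINT u:{a..b}|lebesgue. f u) = integral {a..b} f"
    using absolutely_integrable_continuous_real[OF cont] by (rule set_lebesgue_integral_eq_integral)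

  \<comment> \<open>The s-convexity majorant of \<open>\<bar>f' u\<bar> powr q\<close>, over the
    common denominator \<open>l powr s\<close> so that the shifted power integrals apply
    directly.\<close>
  define G where "G u = ((b - u) powr s * A + (u - a) powr s * B) / l powr s" for u
  have G: "G u \<ge> 0" for u
    using AB by (auto simp: G_def)
  have "(G has_integral (l powr (s + 1) / (s + 1) * A + l powr (s + 1) / (s + 1) * B) / l powr s) {a..b}"
    unfolding G_def l_def using assms
    by (intro has_integral_divide has_integral_add has_integral_mult_left has_integral_shifted_powr) auto
  also have "(l powr (s + 1) / (s + 1) * A + l powr (s + 1) / (s + 1) * B) / l powr s = l * ((A + B) / (s + 1))"
    using l by (simp add: powr_add add_divide_distrib distrib_left)
  finally have "(G has_integral l * ((A + B) / (s + 1))) {a..b}" .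
  then have Gq: "((\<lambda>u. (G u powr (1 / q)) powr q) has_integral l * ((A + B) / (s + 1))) {a..b}"
    using G q by (simp add: powr_powr)
  have f'G: "\<bar>f' u\<bar> \<le> G u powr (1 / q)" if u: "u \<in> {a..b}" for u
  proof -
    \<comment> \<open>The weight of \<open>a\<close> when \<open>u\<close> is written as a convex
      combination of \<open>a\<close> and \<open>b\<close>.\<close>
    define t where "t = (b - u) / l"
    have "t * l = b - u" using l by (simp add: t_def)
    then have "t * a + (1 - t) * b = u" by (simp add: l_def algebra_simps)
    moreover have "t \<in> {0..1}" "1 - t = (u - a) / l"
      using u l by (auto simp: t_def l_def field_simps)
    ultimately have t: "t \<in> {0..1}" "1 - t = (u - a) / l" "t * a + (1 - t) * b = u"
      by auto
    have "\<bar>f' (t * a + (1 - t) * b)\<bar> powr q \<le> t powr s * A + (1 - t) powr s * B"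
      using assms(5,12) t(1) unfolding s_convex_second_on_def A_def B_def by auto
    also have "\<dots> = G u"
      unfolding t(2) using u l by (simp add: t_def G_def powr_divide add_divide_distrib)
    finally have "(\<bar>f' u\<bar> powr q) powr (1 / q) \<le> G u powr (1 / q)"
      unfolding t(3) using q by (intro powr_mono2) auto
    then show ?thesis using q by (simp add: powr_powr)
  qed
  have "\<bar>l * f x - integral {a..b} f\<bar> \<le>
      (((x - a) powr (p + 1) + (b - x) powr (p + 1)) / (p + 1)) powr (1 / p)
      * (l * ((A + B) / (s + 1))) powr (1 / q)"
    \<comment> \<open>Hoelder with the modulus of the kernel as \<open>f\<close> and
      \<open>G u powr (1 / q)\<close> as \<open>g\<close>.\<close>
    unfolding l_def
    by (rule Hoelder_has_integral[OF assms(8,9) has_integral_Ostrowski_kernel[OF der x]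
          has_integral_Ostrowski_kernel_powr[OF x] Gq[unfolded l_def]])
      (use f'G assms(8) in \<open>auto simp: abs_mult intro!: mult_left_mono\<close>)
  \<comment> \<open>Both distances are scaled by \<open>l\<close> to reach the normalised bracket of
    the claim.\<close>
  also have "(x - a) powr (p + 1) + (b - x) powr (p + 1) =
      l powr (p + 1) * (((b - x) / l) powr (p + 1) + ((x - a) / l) powr (p + 1))" (is "_ = _ * ?E")
    using x l by (simp add: powr_divide field_simps)
  also have "(l powr (p + 1) * ?E / (p + 1)) powr (1 / p) * (l * ((A + B) / (s + 1))) powr (1 / q) =
      (l powr ((p + 1) / p) * l powr (1 / q)) / (p + 1) powr (1 / p) * ?E powr (1 / p)
      * ((A + B) / (s + 1)) powr (1 / q)"
    using l assms AB by (simp add: powr_mult powr_divide powr_powr)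
  \<comment> \<open>The exponents add up to \<open>1 + 1 / p + 1 / q = 2\<close>; one factor
    \<open>l\<close> is cancelled by the final division, the other is the \<open>b - a\<close> of
    the bound.\<close>
  also have "l powr ((p + 1) / p) * l powr (1 / q) = l * l"
  proof -
    have "(p + 1) / p + 1 / q = 2" using assms(8,9) by (simp add: add_divide_distrib)
    then show ?thesis using l by (simp add: powr_add[symmetric] power2_eq_square)
  qed
  finally have main: "\<bar>l * f x - integral {a..b} f\<bar> \<le> l * (l / (p + 1) powr (1 / p) * ?E powr (1 / p)
      * ((A + B) / (s + 1)) powr (1 / q))"
    by (simp add: mult.assoc)
  have "\<bar>f x - 1 / l * integral {a..b} f\<bar> = \<bar>l * f x - integral {a..b} f\<bar> / l"
  proof -
    have "f x - 1 / l * integral {a..b} f = (l * f x - integral {a..b} f) / l"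
      using l by (simp add: field_simps)
    then show ?thesis using l by simp
  qed
  also have "\<dots> \<le> l / (p + 1) powr (1 / p) * ?E powr (1 / p) * ((A + B) / (s + 1)) powr (1 / q)"
    using main l by (simp add: pos_divide_le_eq mult.commute)
  finally show ?thesis
    unfolding lint by (simp only: A_def B_def l_def)
qed

end
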